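(* The CN calculus is sound and complete for conditional neighbourhood models: for every formula $\phi$ of $\mathcal{L}_{CN}$, $\phi$ is derivable in the CN calculus if and only if $\mathfrak{M},w\vDash\phi$ for every conditional neighbourhood model $\mathfrak{M}=(W,N,V)$ and every $w\in W$.
   Context: Fix a set $P$ of proposition letters and a finite set $Ag$ of agents. The language $\mathcal{L}_{CN}$ is given by $\phi::=\top\mid p\mid\neg\phi\mid(\phi\wedge\phi)\mid B_a(\phi,\phi)$ with $p\in P$, $a\in Ag$ ($B_a(\phi,\psi)$: "assuming $\phi$, agent $a$ believes $\psi$"). $\bot,\vee,\to,\leftrightarrow$ are defined as usual; $K_a\phi$ abbreviates $\neg B_a(\neg\phi,\top)$ and $\check K_a\phi$ abbreviates $\neg K_a\neg\phi$. A conditional neighbourhood model is $\mathfrak{M}=(W,N,V)$ where $W$ is a non-empty set, $V:P\to\mathcal{P}(W)$ is a valuation, and $N$ assigns to every $a\in Ag$, $w\in W$, $X\subseteq W$ a collection $N_a^w(X)\subseteq\mathcal{P}(W)$ such that, writing $[w]_a=\{v\in W\mid \forall X\subseteq W,\ N_a^w(X)=N_a^v(X)\}$, for all $a,w,X$: (c) every $Y\in N_a^w(X)$ satisfies $Y\subseteq X\cap[w]_a$; (ec) for all $Y\subseteq W$, if $X\cap[w]_a=Y\cap[w]_a$ then $N_a^w(X)=N_a^w(Y)$; (d) for all $Y\in N_a^w(X)$, $(X\cap[w]_a)\setminus Y\notin N_a^w(X)$; (sc) for all $Y,Z\subseteq X\cap[w]_a$, if $(X\cap[w]_a)\setminus Y\notin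 N_a^w(X)$ and $Y\subsetneq Z$, then $Z\in N_a^w(X)$. Truth: $\mathfrak{M},w\vDash\top$ always; $\mathfrak{M},w\vDash p$ iff $w\in V(p)$; Boolean connectives as usual; $\mathfrak{M},w\vDash B_a(\phi,\psi)$ iff there is $Y\in N_a^w(\llbracket\phi\rrbracket_{\mathfrak{M}})$ with $Y\subseteq\llbracket\psi\rrbracket_{\mathfrak{M}}$, where $\llbracket\phi\rrbracket_{\mathfrak{M}}=\{v\in W\mid\mathfrak{M},v\vDash\phi\}$. The CN calculus has axioms: (Taut) all instances of propositional tautologies; (Dist-K) $K_a(\phi\to\psi)\to K_a\phi\to K_a\psi$; (T) $K_a\phi\to\phi$; (5B) $B_a(\phi,\psi)\to K_aB_a(\phi,\psi)$; (4B) $\neg B_a(\phi,\psi)\to K_a\neg B_a(\phi,\psi)$; (D) $B_a(\phi,\psi)\to\neg B_a(\phi,\neg\psi)$; (EC) $K_a(\phi\leftrightarrow\psi)\to B_a(\phi,\chi)\to B_a(\psi,\chi)$; (M) $K_a(\phi\to\psi)\to B_a(\chi,\phi)\to B_a(\chi,\psi)$; (C) $B_a(\phi,\psi)\to B_a(\phi,\phi\wedge\psi)$; (SC) $\neg B_a(\chi,\neg\phi)\wedge\check K_a(\chi\wedge\neg\phi\wedge\psi)\to B_a(\chi,\phi\vee\psi)$; and rules Modus Ponens (from $\phi\to\psi$ and $\phi$ infer $\psi$) and (Nec-K) (from $\phi$ infer $K_a\phi$). *)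

theory Defs
  imports Main
begin

datatype ('p, 'a) fm =
    Top (\<open>\<^bold>\<top>\<close>)
  | Pro 'p
  | Neg \<open>('p, 'a) fm\<close> (\<open>\<^bold>\<not> _\<close> [70] 70)
  | Con \<open>('p, 'a) fm\<close> \<open>('p, 'a) fm\<close> (infixr \<open>\<^bold>\<and>\<close> 65)
  | Bel 'a \<open>('p, 'a) fm\<close> \<open>('p, 'a) fm\<close>

abbreviation Dis (infixr \<open>\<^bold>\<or>\<close> 60) where
  \<open>\<phi> \<^bold>\<or> \<psi> \<equiv> \<^bold>\<not> (\<^bold>\<not> \<phi> \<^bold>\<and> \<^bold>\<not> \<psi>)\<close>

abbreviation Imp (infixr \<open>\<^bold>\<longrightarrow>\<close> 55) where
  \<open>\<phi> \<^bold>\<longrightarrow> \<psi> \<equiv> \<^bold>\<not> (\<phi> \<^bold>\<and> \<^bold>\<not> \<psi>)\<close>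

abbreviation Iff (infix \<open>\<^bold>\<longleftrightarrow>\<close> 55) where
  \<open>\<phi> \<^bold>\<longleftrightarrow> \<psi> \<equiv> (\<phi> \<^bold>\<longrightarrow> \<psi>) \<^bold>\<and> (\<psi> \<^bold>\<longrightarrow> \<phi>)\<close>

abbreviation Know :: \<open>'a \<Rightarrow> ('p, 'a) fm \<Rightarrow> ('p, 'a) fm\<close> where
  \<open>Know a \<phi> \<equiv> \<^bold>\<not> Bel a (\<^bold>\<not> \<phi>) \<^bold>\<top>\<close>

abbreviation Know_dual :: \<open>'a \<Rightarrow> ('p, 'a) fm \<Rightarrow> ('p, 'a) fm\<close> where
  \<open>Know_dual a \<phi> \<equiv> \<^bold>\<not> Know a (\<^bold>\<not> \<phi>)\<close>


type_synonym ('w, 'a) nbh = \<open>'a \<Rightarrow> 'w \<Rightarrow> 'w set \<Rightarrow> 'w set set\<close>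

definition cell :: \<open>'w set \<Rightarrow> ('w, 'a) nbh \<Rightarrow> 'a \<Rightarrow> 'w \<Rightarrow> 'w set\<close> where
  \<open>cell W N a w = {v \<in> W. \<forall>X \<subseteq> W. N a w X = N a v X}\<close>

text \<open>The set of worlds is a subset \<open>W\<close> of the type \<open>'w\<close>. The values of \<open>N\<close> at worlds
  outside \<open>W\<close> or at sets not included in \<open>W\<close> are unconstrained and have no effect on truth
  at worlds of \<open>W\<close>.\<close>

definition cn_model :: \<open>'w set \<Rightarrow> ('w, 'a) nbh \<Rightarrow> ('p \<Rightarrow> 'w set) \<Rightarrow> bool\<close> where
  \<open>cn_model W N V \<longleftrightarrow>
     W \<noteq> {} \<and>
     (\<forall>p. V p \<subseteq> W) \<and>
     (\<forall>a. \<forall>w \<in> W. \<forall>X \<subseteq> W.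
        N a w X \<subseteq> Pow W \<and>
        (\<forall>Y \<in> N a w X. Y \<subseteq> X \<inter> cell W N a w) \<and>
        (\<forall>Y \<subseteq> W. X \<inter> cell W N a w = Y \<inter> cell W N a w \<longrightarrow> N a w X = N a w Y) \<and>
        (\<forall>Y \<in> N a w X. (X \<inter> cell W N a w) - Y \<notin> N a w X) \<and>
        (\<forall>Y Z. Y \<subseteq> X \<inter> cell W N a w \<longrightarrow> Z \<subseteq> X \<inter> cell W N a w \<longrightarrow>
           (X \<inter> cell W N a w) - Y \<notin> N a w X \<longrightarrow> Y \<subset> Z \<longrightarrow> Z \<in> N a w X))\<close>

primrec sat ::
  \<open>'w set \<Rightarrow> ('w, 'a) nbh \<Rightarrow> ('p \<Rightarrow> 'w set) \<Rightarrow> 'w \<Rightarrow> ('p, 'a) fm \<Rightarrow> bool\<close> where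
  \<open>sat W N V w \<^bold>\<top> \<longleftrightarrow> True\<close>
| \<open>sat W N V w (Pro p) \<longleftrightarrow> w \<in> V p\<close>
| \<open>sat W N V w (\<^bold>\<not> \<phi>) \<longleftrightarrow> \<not> sat W N V w \<phi>\<close>
| \<open>sat W N V w (\<phi> \<^bold>\<and> \<psi>) \<longleftrightarrow> sat W N V w \<phi> \<and> sat W N V w \<psi>\<close>
| \<open>sat W N V w (Bel a \<phi> \<psi>) \<longleftrightarrow>
     (\<exists>Y \<in> N a w {v \<in> W. sat W N V v \<phi>}. Y \<subseteq> {v \<in> W. sat W N V v \<psi>})\<close>

text \<open>A formula cannot quantify over types, so validity is relative to the type from which the
  worlds are drawn. Validity over all models is validity over every type \<open>'w\<close>; the type of sets
  of formulas is large enough to contain the worlds of a canonical model.\<close>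

definition cn_valid :: \<open>'w itself \<Rightarrow> ('p, 'a) fm \<Rightarrow> bool\<close> where
  \<open>cn_valid T \<phi> \<longleftrightarrow>
     (\<forall>(W :: 'w set) N V. cn_model W N V \<longrightarrow> (\<forall>w \<in> W. sat W N V w \<phi>))\<close>


text \<open>Propositional formulas have their own supply of letters, so that every propositional
  tautology has instances in the language even if \<open>'p\<close> is finite.\<close>

datatype prop_fm = PTop | PLet nat | PNeg prop_fm | PCon prop_fm prop_fm

primrec prop_eval :: \<open>(nat \<Rightarrow> bool) \<Rightarrow> prop_fm \<Rightarrow> bool\<close> where
  \<open>prop_eval g PTop \<longleftrightarrow> True\<close>
| \<open>prop_eval g (PLet n) \<longleftrightarrow> g n\<close>
| \<open>prop_eval g (PNeg \<tau>) \<longleftrightarrow> \<not> prop_eval g \<tau>\<close>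
| \<open>prop_eval g (PCon \<tau> \<upsilon>) \<longleftrightarrow> prop_eval g \<tau> \<and> prop_eval g \<upsilon>\<close>

primrec prop_inst :: \<open>(nat \<Rightarrow> ('p, 'a) fm) \<Rightarrow> prop_fm \<Rightarrow> ('p, 'a) fm\<close> where
  \<open>prop_inst s PTop = \<^bold>\<top>\<close>
| \<open>prop_inst s (PLet n) = s n\<close>
| \<open>prop_inst s (PNeg \<tau>) = \<^bold>\<not> prop_inst s \<tau>\<close>
| \<open>prop_inst s (PCon \<tau> \<upsilon>) = prop_inst s \<tau> \<^bold>\<and> prop_inst s \<upsilon>\<close>

inductive CN :: \<open>('p, 'a) fm \<Rightarrow> bool\<close> (\<open>\<turnstile> _\<close> [50] 50) where
  Taut: \<open>(\<forall>g. prop_eval g \<tau>) \<Longrightarrow> \<turnstile> prop_inst s \<tau>\<close>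
| DistK: \<open>\<turnstile> Know a (\<phi> \<^bold>\<longrightarrow> \<psi>) \<^bold>\<longrightarrow> Know a \<phi> \<^bold>\<longrightarrow> Know a \<psi>\<close>
| T: \<open>\<turnstile> Know a \<phi> \<^bold>\<longrightarrow> \<phi>\<close>
| B5: \<open>\<turnstile> Bel a \<phi> \<psi> \<^bold>\<longrightarrow> Know a (Bel a \<phi> \<psi>)\<close>
| B4: \<open>\<turnstile> \<^bold>\<not> Bel a \<phi> \<psi> \<^bold>\<longrightarrow> Know a (\<^bold>\<not> Bel a \<phi> \<psi>)\<close>
| D: \<open>\<turnstile> Bel a \<phi> \<psi> \<^bold>\<longrightarrow> \<^bold>\<not> Bel a \<phi> (\<^bold>\<not> \<psi>)\<close>
| EC: \<open>\<turnstile> Know a (\<phi> \<^bold>\<longleftrightarrow> \<psi>) \<^bold>\<longrightarrow> Bel a \<phi> \<chi> \<^bold>\<longrightarrow> Bel a \<psi> \<chi>\<close>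
| M: \<open>\<turnstile> Know a (\<phi> \<^bold>\<longrightarrow> \<psi>) \<^bold>\<longrightarrow> Bel a \<chi> \<phi> \<^bold>\<longrightarrow> Bel a \<chi> \<psi>\<close>
| C: \<open>\<turnstile> Bel a \<phi> \<psi> \<^bold>\<longrightarrow> Bel a \<phi> (\<phi> \<^bold>\<and> \<psi>)\<close>
| SC: \<open>\<turnstile> \<^bold>\<not> Bel a \<chi> (\<^bold>\<not> \<phi>) \<^bold>\<and> Know_dual a (\<chi> \<^bold>\<and> \<^bold>\<not> \<phi> \<^bold>\<and> \<psi>) \<^bold>\<longrightarrow> Bel a \<chi> (\<phi> \<^bold>\<or> \<psi>)\<close>
| MP: \<open>\<turnstile> \<phi> \<^bold>\<longrightarrow> \<psi> \<Longrightarrow> \<turnstile> \<phi> \<Longrightarrow> \<turnstile> \<psi>\<close>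
| NecK: \<open>\<turnstile> \<phi> \<Longrightarrow> \<turnstile> Know a \<phi>\<close>

end

theory Submission imports Defs begin

text \<open>
  Completeness is by a canonical model on the maximal consistent sets. For an agent \<open>a\<close>, a class
  \<open>C\<close> of worlds with the same beliefs of \<open>a\<close>, and a set \<open>A \<subseteq> C\<close>, the formulas \<open>B\<^sub>a(\<phi>, \<psi>)\<close> with
  \<open>\<lbrakk>\<phi>\<rbrakk> \<inter> C = A\<close> prescribe which definable subsets of \<open>A\<close> are neighbourhoods. The axioms say that this
  family satisfies (d) and (sc) among definable sets. It remains to extend it to all subsets of
  \<open>A\<close> without adding definable ones: close it under supersets, add all proper supersets of definable
  sets that are tied with their complement, and let a fixed point of \<open>A\<close> decide between the other
  undecided sets and their complements.
\<close>

section \<open>Soundness\<close>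

locale nbh_model =
  fixes W :: \<open>'w set\<close> and N :: \<open>('w, 'a) nbh\<close> and V :: \<open>'p \<Rightarrow> 'w set\<close>
  assumes model: \<open>cn_model W N V\<close>
begin

abbreviation ext :: \<open>('p, 'a) fm \<Rightarrow> 'w set\<close> where
  \<open>ext \<phi> \<equiv> {v \<in> W. sat W N V v \<phi>}\<close>

lemmas nbh_conditions = model[unfolded cn_model_def, THEN conjunct2, THEN conjunct2,
    THEN spec, THEN bspec, THEN spec, THEN mp, THEN conjunct2]

lemma nbh_sub:
  assumes \<open>w \<in> W\<close> \<open>X \<subseteq> W\<close> \<open>Y \<in> N a w X\<close>
  shows \<open>Y \<subseteq> X \<inter> cell W N a w\<close>
  using nbh_conditions[OF assms(1,2), THEN conjunct1] assms(3) by (rule bspec)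

lemma nbh_ec:
  assumes \<open>w \<in> W\<close> \<open>X \<subseteq> W\<close> \<open>Y \<subseteq> W\<close> \<open>X \<inter> cell W N a w = Y \<inter> cell W N a w\<close>
  shows \<open>N a w X = N a w Y\<close>
  by (rule nbh_conditions[OF assms(1,2), THEN conjunct2, THEN conjunct1, THEN spec, THEN mp,
        THEN mp, OF assms(3,4)])

lemma nbh_d:
  assumes \<open>w \<in> W\<close> \<open>X \<subseteq> W\<close> \<open>Y \<in> N a w X\<close>
  shows \<open>X \<inter> cell W N a w - Y \<notin> N a w X\<close>
  using nbh_conditions[OF assms(1,2), THEN conjunct2, THEN conjunct2, THEN conjunct1] assms(3)
  by (rule bspec)

lemma nbh_sc:
  assumes \<open>w \<in> W\<close> \<open>X \<subseteq> W\<close> \<open>Z \<subseteq> X \<inter> cell W N a w\<close>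
    and \<open>X \<inter> cell W N a w - Y \<notin> N a w X\<close> \<open>Y \<subset> Z\<close>
  shows \<open>Z \<in> N a w X\<close>
proof -
  have \<open>Y \<subseteq> X \<inter> cell W N a w\<close>
    using assms(3,5) by blast
  then show ?thesis
    using nbh_conditions[OF assms(1,2), THEN conjunct2, THEN conjunct2, THEN conjunct2] assms(3-5)
    by simp
qed

text \<open>By (d) the complement of a neighbourhood is not a neighbourhood, so (sc) applies to
  every proper superset.\<close>

lemma nbh_mono:
  \<open>w \<in> W \<Longrightarrow> X \<subseteq> W \<Longrightarrow> Y \<in> N a w X \<Longrightarrow> Y \<subseteq> Z \<Longrightarrow> Z \<subseteq> X \<inter> cell W N a w \<Longrightarrow> Z \<in> N a w X\<close>
  using nbh_d nbh_sc by (metis psubsetI)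

lemma cell_sub: \<open>cell W N a w \<subseteq> W\<close>
  by (auto simp: cell_def)

lemma cell_refl: \<open>w \<in> W \<Longrightarrow> w \<in> cell W N a w\<close>
  by (auto simp: cell_def)

lemma nbh_cell: \<open>v \<in> cell W N a w \<Longrightarrow> X \<subseteq> W \<Longrightarrow> N a v X = N a w X\<close>
  by (auto simp: cell_def)

text \<open>If the family is empty, (sc) with the empty set as the smaller set would put a non-empty
  intersection of \<open>X\<close> with the cell into it. Conversely, the only candidate below the
  empty set is its own complement, which (d) excludes.\<close>

lemma nbh_empty_iff:
  assumes \<open>w \<in> W\<close> \<open>X \<subseteq> W\<close>
  shows \<open>N a w X = {} \<longleftrightarrow> X \<inter> cell W N a w = {}\<close>
proof
  show \<open>X \<inter> cell W N a w = {}\<close> if \<open>N a w X = {}\<close>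
    using that nbh_sc[OF assms, of \<open>X \<inter> cell W N a w\<close> a \<open>{}\<close>] by blast
  show \<open>N a w X = {}\<close> if \<open>X \<inter> cell W N a w = {}\<close>
    using that nbh_d[OF assms, of _ a] nbh_sub[OF assms, of _ a] by (metis Diff_empty bot.extremum_uniqueI equals0I)
qed

text \<open>By monotonicity a witness can be enlarged to the largest candidate, so the existential
  clause becomes a single membership. Soundness of D, M, C and SC is read off from this
  form.\<close>

lemma sat_Bel_iff:
  assumes \<open>w \<in> W\<close>
  shows \<open>sat W N V w (Bel a \<phi> \<psi>) \<longleftrightarrow> ext \<phi> \<inter> cell W N a w \<inter> ext \<psi> \<in> N a w (ext \<phi>)\<close>
proof
  assume \<open>sat W N V w (Bel a \<phi> \<psi>)\<close>
  then obtain Y where Y: \<open>Y \<in> N a w (ext \<phi>)\<close> \<open>Y \<subseteq> ext \<psi>\<close> by auto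
  then show \<open>ext \<phi> \<inter> cell W N a w \<inter> ext \<psi> \<in> N a w (ext \<phi>)\<close>
    using nbh_sub[OF assms _ Y(1)] by (intro nbh_mono[OF assms _ Y(1)]) auto
next
  assume \<open>ext \<phi> \<inter> cell W N a w \<inter> ext \<psi> \<in> N a w (ext \<phi>)\<close>
  then show \<open>sat W N V w (Bel a \<phi> \<psi>)\<close>
    unfolding sat.simps by (rule bexI[rotated]) blast
qed

text \<open>Every neighbourhood lies in the truth set of \<open>Top\<close>, so \<open>Know\<close>
  says that the truth set of the negation has no neighbourhood at all; by
  \<open>nbh_empty_iff\<close> it then misses the cell.\<close>

lemma sat_Know:
  assumes \<open>w \<in> W\<close>
  shows \<open>sat W N V w (Know a \<phi>) \<longleftrightarrow> (\<forall>v \<in> cell W N a w. sat W N V v \<phi>)\<close>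
proof -
  have \<open>Y \<subseteq> W\<close> if \<open>Y \<in> N a w (ext (\<^bold>\<not> \<phi>))\<close> for Y
    using nbh_sub[OF assms _ that] by auto
  then have \<open>sat W N V w (Know a \<phi>) \<longleftrightarrow> N a w (ext (\<^bold>\<not> \<phi>)) = {}\<close>
    by fastforce
  also have \<open>\<dots> \<longleftrightarrow> ext (\<^bold>\<not> \<phi>) \<inter> cell W N a w = {}\<close>
    by (intro nbh_empty_iff assms) auto
  also have \<open>\<dots> \<longleftrightarrow> (\<forall>v \<in> cell W N a w. sat W N V v \<phi>)\<close>
    using cell_sub[of a w] by auto
  finally show ?thesis .
qed

lemma sat_Bel_cell:
  assumes \<open>v \<in> cell W N a w\<close>
  shows \<open>sat W N V v (Bel a \<phi> \<psi>) \<longleftrightarrow> sat W N V w (Bel a \<phi> \<psi>)\<close>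
  using nbh_cell[OF assms, of \<open>ext \<phi>\<close>] by simp

lemma sat_prop_inst: \<open>sat W N V w (prop_inst s \<tau>) \<longleftrightarrow> prop_eval (\<lambda>n. sat W N V w (s n)) \<tau>\<close>
  by (induction \<tau>) auto

text \<open>Unfolding this equation stops at the implication and keeps \<open>Know\<close> folded,
  so that \<open>sat_Know\<close> still applies; the clauses of \<open>sat\<close> would open it
  into its belief form.\<close>

lemma sat_Imp: \<open>sat W N V w (\<phi> \<^bold>\<longrightarrow> \<psi>) \<longleftrightarrow> (sat W N V w \<phi> \<longrightarrow> sat W N V w \<psi>)\<close>
  by simp

lemma sat_Neg: \<open>sat W N V w (\<^bold>\<not> \<phi>) \<longleftrightarrow> \<not> sat W N V w \<phi>\<close>
  by simp

lemma soundness: \<open>\<turnstile> \<phi> \<Longrightarrow> w \<in> W \<Longrightarrow> sat W N V w \<phi>\<close>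
proof (induction \<phi> arbitrary: w rule: CN.induct)
  case (Taut \<tau> s)
  then show ?case by (simp add: sat_prop_inst)
next
  case (DistK a \<phi> \<psi>)
  then show ?case unfolding sat_Imp sat_Know[OF DistK] by blast
next
  case (T a \<phi>)
  then show ?case unfolding sat_Imp sat_Know[OF T] using cell_refl by blast
next
  case (B5 a \<phi> \<psi>)
  then show ?case unfolding sat_Imp sat_Know[OF B5] using sat_Bel_cell by blast
next
  case (B4 a \<phi> \<psi>)
  then show ?case unfolding sat_Imp sat_Know[OF B4] sat_Neg[of _ \<open>Bel a \<phi> \<psi>\<close>] using sat_Bel_cell by blast
next
  case (D a \<phi> \<psi>)
  have \<open>ext \<phi> \<inter> cell W N a w \<inter> ext (\<^bold>\<not> \<psi>) = ext \<phi> \<inter> cell W N a w - ext \<phi> \<inter> cell W N a w \<inter> ext \<psi>\<close>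
    by auto
  then show ?case
    unfolding sat_Imp sat_Neg[of _ \<open>Bel _ _ _\<close>] sat_Bel_iff[OF D]
    using nbh_d[OF D, of \<open>ext \<phi>\<close> \<open>ext \<phi> \<inter> cell W N a w \<inter> ext \<psi>\<close> a] by simp
next
  case (EC a \<phi> \<psi> \<chi>)
  show ?case
  proof (unfold sat_Imp sat_Know[OF EC], intro impI)
    assume *: \<open>\<forall>v \<in> cell W N a w. sat W N V v (\<phi> \<^bold>\<longleftrightarrow> \<psi>)\<close> and B: \<open>sat W N V w (Bel a \<phi> \<chi>)\<close>
    have \<open>ext \<phi> \<inter> cell W N a w = ext \<psi> \<inter> cell W N a w\<close>
      using * by auto
    then have \<open>N a w (ext \<phi>) = N a w (ext \<psi>)\<close>
      by (intro nbh_ec EC) auto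
    then show \<open>sat W N V w (Bel a \<psi> \<chi>)\<close>
      using B by simp
  qed
next
  case (M a \<phi> \<psi> \<chi>)
  show ?case
  proof (unfold sat_Imp sat_Know[OF M] sat_Bel_iff[OF M], intro impI)
    assume *: \<open>\<forall>v \<in> cell W N a w. sat W N V v \<phi> \<longrightarrow> sat W N V v \<psi>\<close>
      and B: \<open>ext \<chi> \<inter> cell W N a w \<inter> ext \<phi> \<in> N a w (ext \<chi>)\<close>
    show \<open>ext \<chi> \<inter> cell W N a w \<inter> ext \<psi> \<in> N a w (ext \<chi>)\<close>
      by (rule nbh_mono[OF M _ B]) (use * in auto)
  qed
next
  case (C a \<phi> \<psi>)
  have \<open>ext \<phi> \<inter> cell W N a w \<inter> ext (\<phi> \<^bold>\<and> \<psi>) = ext \<phi> \<inter> cell W N a w \<inter> ext \<psi>\<close>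
    by auto
  then show ?case
    unfolding sat_Imp sat_Bel_iff[OF C] by simp
next
  case (SC a \<chi> \<phi> \<psi>)
  let ?A = \<open>ext \<chi> \<inter> cell W N a w\<close>
  have eq: \<open>?A \<inter> ext (\<^bold>\<not> \<phi>) = ?A - ?A \<inter> ext \<phi>\<close>
    by auto
  \<comment> \<open>The smaller set in (sc) is the part of \<open>?A\<close> where \<phi> holds; its
    complement in \<open>?A\<close> is the part where \<phi> fails. The world \<open>v\<close> lies
    in the larger set only, which makes the inclusion strict.\<close>
  have \<open>?A \<inter> ext (\<phi> \<^bold>\<or> \<psi>) \<in> N a w (ext \<chi>)\<close>
    if \<open>?A \<inter> ext (\<^bold>\<not> \<phi>) \<notin> N a w (ext \<chi>)\<close> and v: \<open>v \<in> cell W N a w\<close> \<open>sat W N V v (\<chi> \<^bold>\<and> \<^bold>\<not> \<phi> \<^bold>\<and> \<psi>)\<close>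
    for v
  proof (rule nbh_sc[OF SC, where Y = \<open>?A \<inter> ext \<phi>\<close>])
    show \<open>?A \<inter> ext \<phi> \<subset> ?A \<inter> ext (\<phi> \<^bold>\<or> \<psi>)\<close>
      using v cell_sub[of a w] by (intro psubsetI) auto
  qed (use that eq in auto)
  moreover have \<open>\<exists>v \<in> cell W N a w. sat W N V v (\<chi> \<^bold>\<and> \<^bold>\<not> \<phi> \<^bold>\<and> \<psi>)\<close>
    if \<open>sat W N V w (Know_dual a (\<chi> \<^bold>\<and> \<^bold>\<not> \<phi> \<^bold>\<and> \<psi>))\<close>
    using that unfolding sat_Neg[of _ \<open>Know a _\<close>] sat_Know[OF SC] by simp
  moreover have \<open>?A \<inter> ext (\<^bold>\<not> \<phi>) \<notin> N a w (ext \<chi>)\<close> if \<open>sat W N V w (\<^bold>\<not> Bel a \<chi> (\<^bold>\<not> \<phi>))\<close>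
    using that sat_Bel_iff[OF SC, of a \<chi> \<open>\<^bold>\<not> \<phi>\<close>] unfolding sat_Neg[of _ \<open>Bel _ _ _\<close>] by blast
  moreover have \<open>sat W N V w (Bel a \<chi> (\<phi> \<^bold>\<or> \<psi>))\<close> if \<open>?A \<inter> ext (\<phi> \<^bold>\<or> \<psi>) \<in> N a w (ext \<chi>)\<close>
    using that sat_Bel_iff[OF SC] by blast
  ultimately show ?case
    unfolding sat_Imp[of _ \<open>_ \<^bold>\<and> Know_dual a _\<close>] sat.simps(4)[of _ _ _ _ _ \<open>Know_dual a _\<close>] by blast
next
  case (MP \<phi> \<psi>)
  from MP.IH[OF MP.prems] show ?case unfolding sat_Imp by (rule mp)
next
  case (NecK \<phi> a)
  have \<open>v \<in> W\<close> if \<open>v \<in> cell W N a w\<close> for v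
    using that cell_sub by blast
  then show ?case unfolding sat_Know[OF NecK(3)] using NecK.IH by blast
qed

end

lemma CN_sound: \<open>\<turnstile> \<phi> \<Longrightarrow> cn_valid TYPE('w) \<phi>\<close>
  unfolding cn_valid_def by (auto intro: nbh_model.soundness nbh_model.intro)

section \<open>Maximal consistent sets\<close>

abbreviation PImp :: \<open>prop_fm \<Rightarrow> prop_fm \<Rightarrow> prop_fm\<close> where
  \<open>PImp \<tau> \<upsilon> \<equiv> PNeg (PCon \<tau> (PNeg \<upsilon>))\<close>

text \<open>The substitution \<open>nth [p, q]\<close> sends letter n to entry n of the list.
  Simplification both checks the propositional scheme and computes its instance; the next lemmas
  follow the same pattern.\<close>

lemma CN_weaken: \<open>\<turnstile> p \<^bold>\<longrightarrow> q \<^bold>\<longrightarrow> p\<close>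
  using Taut[of \<open>PImp (PLet 0) (PImp (PLet 1) (PLet 0))\<close> \<open>nth [p, q]\<close>] by simp

lemma CN_distrib: \<open>\<turnstile> (p \<^bold>\<longrightarrow> q \<^bold>\<longrightarrow> r) \<^bold>\<longrightarrow> (p \<^bold>\<longrightarrow> q) \<^bold>\<longrightarrow> p \<^bold>\<longrightarrow> r\<close>
  using Taut[of \<open>PImp (PImp (PLet 0) (PImp (PLet 1) (PLet 2)))
    (PImp (PImp (PLet 0) (PLet 1)) (PImp (PLet 0) (PLet 2)))\<close> \<open>nth [p, q, r]\<close>]
  by (simp add: numeral_2_eq_2)

lemma CN_refl: \<open>\<turnstile> p \<^bold>\<longrightarrow> p\<close>
  using Taut[of \<open>PImp (PLet 0) (PLet 0)\<close> \<open>nth [p]\<close>] by simp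

lemma CN_Top: \<open>\<turnstile> \<^bold>\<top>\<close>
  using Taut[of PTop] by simp

lemma CN_explode: \<open>\<turnstile> \<^bold>\<not> p \<^bold>\<longrightarrow> p \<^bold>\<longrightarrow> q\<close>
  using Taut[of \<open>PImp (PNeg (PLet 0)) (PImp (PLet 0) (PLet 1))\<close> \<open>nth [p, q]\<close>] by simp

lemma CN_contr: \<open>\<turnstile> (\<^bold>\<not> p \<^bold>\<longrightarrow> \<^bold>\<not> \<^bold>\<top>) \<^bold>\<longrightarrow> p\<close>
  using Taut[of \<open>PImp (PImp (PNeg (PLet 0)) (PNeg PTop)) (PLet 0)\<close> \<open>nth [p]\<close>] by simp

lemma CN_conI: \<open>\<turnstile> p \<^bold>\<longrightarrow> q \<^bold>\<longrightarrow> p \<^bold>\<and> q\<close>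
  using Taut[of \<open>PImp (PLet 0) (PImp (PLet 1) (PCon (PLet 0) (PLet 1)))\<close> \<open>nth [p, q]\<close>] by simp

lemma CN_conE1: \<open>\<turnstile> p \<^bold>\<and> q \<^bold>\<longrightarrow> p\<close>
  using Taut[of \<open>PImp (PCon (PLet 0) (PLet 1)) (PLet 0)\<close> \<open>nth [p, q]\<close>] by simp

lemma CN_conE2: \<open>\<turnstile> p \<^bold>\<and> q \<^bold>\<longrightarrow> q\<close>
  using Taut[of \<open>PImp (PCon (PLet 0) (PLet 1)) (PLet 1)\<close> \<open>nth [p, q]\<close>] by simp

text \<open>Hypotheses are combined by modus ponens alone, and necessitation stays inside the
  theorems. This is what makes the deduction theorem hold.\<close>

inductive Der :: \<open>('p, 'a) fm set \<Rightarrow> ('p, 'a) fm \<Rightarrow> bool\<close> for G where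
  Hyp: \<open>\<phi> \<in> G \<Longrightarrow> Der G \<phi>\<close>
| Thm: \<open>\<turnstile> \<phi> \<Longrightarrow> Der G \<phi>\<close>
| Mp: \<open>Der G (\<phi> \<^bold>\<longrightarrow> \<psi>) \<Longrightarrow> Der G \<phi> \<Longrightarrow> Der G \<psi>\<close>

lemma Der_mono: \<open>Der G \<phi> \<Longrightarrow> G \<subseteq> H \<Longrightarrow> Der H \<phi>\<close>
  by (induction rule: Der.induct) (auto intro: Der.intros)

lemma Der_empty: \<open>Der {} \<phi> \<Longrightarrow> \<turnstile> \<phi>\<close>
  by (induction rule: Der.induct) (auto intro: MP)

lemma Der_deduct:
  assumes \<open>Der (insert p G) \<phi>\<close>
  shows \<open>Der G (p \<^bold>\<longrightarrow> \<phi>)\<close>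
  using assms
proof (induction rule: Der.induct)
  case (Hyp \<phi>)
  then show ?case
    by (metis CN_refl CN_weaken Der.Hyp Mp Thm insertE)
next
  case (Thm \<phi>)
  then show ?case by (meson CN_weaken Der.Thm MP)
next
  case (Mp \<phi> \<psi>)
  then show ?case by (meson CN_distrib Der.Mp Thm)
qed

text \<open>Compactness: a contradiction derived from the union of a chain already follows from one
  member of the chain.\<close>

lemma Der_finite:
  assumes \<open>Der G \<phi>\<close>
  shows \<open>\<exists>F. finite F \<and> F \<subseteq> G \<and> Der F \<phi>\<close>
  using assms
proof (induction rule: Der.induct)
  case (Hyp \<phi>)
  then show ?case by (intro exI[of _ \<open>{\<phi>}\<close>]) (auto intro: Der.Hyp)
next
  case (Thm \<phi>)
  then show ?case by (intro exI[of _ \<open>{}\<close>]) (auto intro: Der.Thm)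
next
  case (Mp \<phi> \<psi>)
  then obtain F F' where F: \<open>finite F\<close> \<open>F \<subseteq> G\<close> \<open>Der F (\<phi> \<^bold>\<longrightarrow> \<psi>)\<close>
    and F': \<open>finite F'\<close> \<open>F' \<subseteq> G\<close> \<open>Der F' \<phi>\<close>
    by blast
  have \<open>Der (F \<union> F') \<psi>\<close>
    using Der.Mp Der_mono[OF F(3)] Der_mono[OF F'(3)] by blast
  with F F' show ?case by (intro exI[of _ \<open>F \<union> F'\<close>]) auto
qed

abbreviation consistent :: \<open>('p, 'a) fm set \<Rightarrow> bool\<close> where
  \<open>consistent G \<equiv> \<not> Der G (\<^bold>\<not> \<^bold>\<top>)\<close>

definition mcs :: \<open>('p, 'a) fm set \<Rightarrow> bool\<close> where
  \<open>mcs w \<longleftrightarrow> consistent w \<and> (\<forall>H. consistent H \<longrightarrow> w \<subseteq> H \<longrightarrow> H = w)\<close>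

text \<open>Zorn's lemma replaces an enumeration of the formulas, since the type of letters may be
  uncountable.\<close>

lemma Lindenbaum:
  assumes \<open>consistent G\<close>
  shows \<open>\<exists>w. mcs w \<and> G \<subseteq> w\<close>
proof -
  have \<open>\<exists>w\<in>{H. consistent H \<and> G \<subseteq> H}. \<forall>H\<in>{H. consistent H \<and> G \<subseteq> H}. w \<subseteq> H \<longrightarrow> H = w\<close>
  proof (rule subset_Zorn_nonempty)
    show \<open>{H. consistent H \<and> G \<subseteq> H} \<noteq> {}\<close> using assms by blast
  next
    fix \<C> assume \<C>: \<open>\<C> \<noteq> {}\<close> \<open>subset.chain {H. consistent H \<and> G \<subseteq> H} \<C>\<close>
    have \<open>consistent (\<Union>\<C>)\<close>
    proof
      assume \<open>Der (\<Union>\<C>) (\<^bold>\<not> \<^bold>\<top>)\<close>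
      then obtain F where F: \<open>finite F\<close> \<open>F \<subseteq> \<Union>\<C>\<close> \<open>Der F (\<^bold>\<not> \<^bold>\<top>)\<close>
        using Der_finite by blast
      then obtain H where \<open>H \<in> \<C>\<close> \<open>F \<subseteq> H\<close>
        using finite_subset_Union_chain[OF F(1,2) \<C>] by blast
      moreover have \<open>consistent H\<close> if \<open>H \<in> \<C>\<close> for H
        using \<C>(2) that unfolding subset.chain_def by blast
      ultimately show False
        using Der_mono[OF F(3)] by blast
    qed
    moreover have \<open>G \<subseteq> \<Union>\<C>\<close>
      using \<C> unfolding subset.chain_def by blast
    ultimately show \<open>\<Union>\<C> \<in> {H. consistent H \<and> G \<subseteq> H}\<close>
      by simp
  qed
  then obtain w where w: \<open>consistent w\<close> \<open>G \<subseteq> w\<close>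
    and max: \<open>\<And>H. consistent H \<Longrightarrow> G \<subseteq> H \<Longrightarrow> w \<subseteq> H \<Longrightarrow> H = w\<close>
    by auto
  have \<open>mcs w\<close>
    unfolding mcs_def using w max[OF _ order_trans[OF w(2)]] by simp
  with w(2) show ?thesis by blast
qed

text \<open>A contradiction from the negation would turn into a derivation of \<open>p\<close> by
  the deduction theorem and \<open>CN_contr\<close>.\<close>

lemma consistent_insert: \<open>\<not> Der G p \<Longrightarrow> consistent (insert (\<^bold>\<not> p) G)\<close>
  using Der_deduct CN_contr Mp Thm by metis

lemma mcs_consistent: \<open>mcs w \<Longrightarrow> consistent w\<close>
  by (simp add: mcs_def)

lemma mcs_insert:
  assumes \<open>mcs w\<close> \<open>consistent (insert \<phi> w)\<close>
  shows \<open>\<phi> \<in> w\<close>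
proof -
  have \<open>insert \<phi> w = w\<close>
    using assms subset_insertI unfolding mcs_def by metis
  then show ?thesis by blast
qed

lemma mcs_Der:
  assumes \<open>mcs w\<close>
  shows \<open>Der w \<phi> \<longleftrightarrow> \<phi> \<in> w\<close>
proof
  assume \<open>Der w \<phi>\<close>
  then have \<open>consistent (insert \<phi> w)\<close>
    using Mp[OF Der_deduct] mcs_consistent[OF assms] by metis
  then show \<open>\<phi> \<in> w\<close>
    using mcs_insert assms by metis
qed (rule Hyp)

lemma mcs_thm: \<open>mcs w \<Longrightarrow> \<turnstile> \<phi> \<Longrightarrow> \<phi> \<in> w\<close>
  using mcs_Der Thm by metis

lemma mcs_mp: \<open>mcs w \<Longrightarrow> \<turnstile> \<phi> \<^bold>\<longrightarrow> \<psi> \<Longrightarrow> \<phi> \<in> w \<Longrightarrow> \<psi> \<in> w\<close>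
  using mcs_Der Mp[OF Thm] by metis

lemma mcs_Neg:
  assumes w: \<open>mcs w\<close>
  shows \<open>\<^bold>\<not> \<phi> \<in> w \<longleftrightarrow> \<phi> \<notin> w\<close>
proof
  show \<open>\<phi> \<notin> w\<close> if \<open>\<^bold>\<not> \<phi> \<in> w\<close>
    using Mp[OF Mp[OF Thm[OF CN_explode] Hyp[OF that]] Hyp] mcs_consistent[OF w] by metis
  show \<open>\<^bold>\<not> \<phi> \<in> w\<close> if \<open>\<phi> \<notin> w\<close>
    using mcs_insert[OF w consistent_insert] that mcs_Der[OF w] by metis
qed

lemma mcs_Con:
  assumes w: \<open>mcs w\<close>
  shows \<open>\<phi> \<^bold>\<and> \<psi> \<in> w \<longleftrightarrow> \<phi> \<in> w \<and> \<psi> \<in> w\<close>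
proof
  show \<open>\<phi> \<in> w \<and> \<psi> \<in> w\<close> if \<open>\<phi> \<^bold>\<and> \<psi> \<in> w\<close>
    using that mcs_mp[OF w CN_conE1] mcs_mp[OF w CN_conE2] by metis
  show \<open>\<phi> \<^bold>\<and> \<psi> \<in> w\<close> if \<open>\<phi> \<in> w \<and> \<psi> \<in> w\<close>
    using Mp[OF Mp[OF Thm[OF CN_conI] Hyp] Hyp] that mcs_Der[OF w] by metis
qed

lemma mcs_Top: \<open>mcs w \<Longrightarrow> \<^bold>\<top> \<in> w\<close>
  by (rule mcs_thm[OF _ CN_Top])

lemmas mcs_simps = mcs_Neg mcs_Con mcs_Top

section \<open>Knowledge and belief in the canonical model\<close>

definition worlds :: \<open>('p, 'a) fm set set\<close> where
  \<open>worlds = {w. mcs w}\<close>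

text \<open>The cell is described by formulas first because \<open>can_nbh\<close> is built from it;
  \<open>cell_can_nbh\<close> shows that these neighbourhoods induce the same cell.\<close>

definition can_cell :: \<open>'a \<Rightarrow> ('p, 'a) fm set \<Rightarrow> ('p, 'a) fm set set\<close> where
  \<open>can_cell a w = {v. mcs v \<and> (\<forall>\<phi> \<psi>. Bel a \<phi> \<psi> \<in> v \<longleftrightarrow> Bel a \<phi> \<psi> \<in> w)}\<close>

definition proof_set :: \<open>('p, 'a) fm \<Rightarrow> ('p, 'a) fm set set\<close> where
  \<open>proof_set \<phi> = {w. mcs w \<and> \<phi> \<in> w}\<close>

lemma can_cell_mcs: \<open>v \<in> can_cell a w \<Longrightarrow> mcs v\<close>
  by (simp add: can_cell_def)

lemma can_cell_refl: \<open>mcs w \<Longrightarrow> w \<in> can_cell a w\<close>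
  by (simp add: can_cell_def)

lemma can_cell_eq: \<open>v \<in> can_cell a w \<Longrightarrow> can_cell a v = can_cell a w\<close>
  by (auto simp: can_cell_def)

text \<open>A derivation is carried out under \<open>Know\<close>: \<open>DistK\<close> mirrors
  modus ponens and \<open>NecK\<close> lifts the theorems.\<close>

lemma Der_Know:
  assumes \<open>Der G \<chi>\<close> and \<open>mcs w\<close> and \<open>\<And>\<gamma>. \<gamma> \<in> G \<Longrightarrow> Know a \<gamma> \<in> w\<close>
  shows \<open>Know a \<chi> \<in> w\<close>
  using assms(1)
proof (induction rule: Der.induct)
  case (Mp \<phi> \<psi>)
  then show ?case
    using DistK assms(2) mcs_Der mcs_mp Der.Mp by metis
next
  case (Hyp \<phi>)
  then show ?case by (rule assms(3))
next
  case (Thm \<phi>)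
  then show ?case by (intro mcs_thm[OF assms(2)] NecK)
qed

text \<open>Knowledge formulas are negated beliefs, hence shared by the whole cell, and T brings
  them down to facts. Conversely, what holds throughout the cell is derivable from the beliefs and
  non-beliefs of the agent, and these are known by 5B and 4B.\<close>

lemma mcs_Know:
  assumes w: \<open>mcs w\<close>
  shows \<open>Know a \<chi> \<in> w \<longleftrightarrow> (\<forall>v \<in> can_cell a w. \<chi> \<in> v)\<close>
proof
  assume \<open>Know a \<chi> \<in> w\<close>
  then have \<open>Know a \<chi> \<in> v\<close> if \<open>v \<in> can_cell a w\<close> for v
    using that w by (simp add: can_cell_def mcs_Neg)
  then show \<open>\<forall>v \<in> can_cell a w. \<chi> \<in> v\<close>
    using mcs_mp[OF can_cell_mcs T] by metis
next
  assume all: \<open>\<forall>v \<in> can_cell a w. \<chi> \<in> v\<close>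
  \<comment> \<open>A maximal consistent set contains \<open>?G\<close> exactly when it lies in the
    cell, so \<open>?G\<close> axiomatizes the cell.\<close>
  let ?G = \<open>{Bel a \<phi> \<psi> |\<phi> \<psi>. Bel a \<phi> \<psi> \<in> w} \<union> {\<^bold>\<not> Bel a \<phi> \<psi> |\<phi> \<psi>. \<^bold>\<not> Bel a \<phi> \<psi> \<in> w}\<close>
  have \<open>Der ?G \<chi>\<close>
  proof (rule ccontr)
    assume \<open>\<not> Der ?G \<chi>\<close>
    then obtain v where v: \<open>mcs v\<close> \<open>insert (\<^bold>\<not> \<chi>) ?G \<subseteq> v\<close>
      using Lindenbaum[OF consistent_insert] by blast
    have \<open>Bel a \<phi> \<psi> \<in> v\<close> if \<open>Bel a \<phi> \<psi> \<in> w\<close> for \<phi> \<psi>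
      using v(2) that by blast
    moreover have \<open>\<^bold>\<not> Bel a \<phi> \<psi> \<in> v\<close> if \<open>\<^bold>\<not> Bel a \<phi> \<psi> \<in> w\<close> for \<phi> \<psi>
      using v(2) that by blast
    ultimately have \<open>Bel a \<phi> \<psi> \<in> v \<longleftrightarrow> Bel a \<phi> \<psi> \<in> w\<close> for \<phi> \<psi>
      using mcs_Neg[OF w] mcs_Neg[OF v(1)] by metis
    then have \<open>v \<in> can_cell a w\<close>
      using v by (simp add: can_cell_def)
    then have \<open>\<chi> \<in> v\<close>
      using all by blast
    then show False
      using v mcs_Neg[OF v(1), of \<chi>] by simp
  qed
  then show \<open>Know a \<chi> \<in> w\<close>
    by (rule Der_Know[OF _ w]) (auto intro: mcs_mp[OF w B4] mcs_mp[OF w B5])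
qed

text \<open>Inside a cell, inclusions between sets of worlds are known implications by
  \<open>mcs_Know\<close>. C first restricts the belief to the worlds of the condition, M then
  weakens it, and EC exchanges the condition. Belief thus becomes a property of sets.\<close>

lemma mcs_Bel_transfer:
  assumes w: \<open>mcs w\<close> and B: \<open>Bel a \<phi> \<psi> \<in> w\<close>
    and \<phi>: \<open>proof_set \<phi> \<inter> can_cell a w = proof_set \<phi>' \<inter> can_cell a w\<close>
    and \<psi>: \<open>proof_set \<phi> \<inter> proof_set \<psi> \<inter> can_cell a w \<subseteq> proof_set \<psi>'\<close>
  shows \<open>Bel a \<phi>' \<psi>' \<in> w\<close>
proof -
  have mp: \<open>q \<in> w\<close> if \<open>p \<^bold>\<longrightarrow> q \<in> w\<close> \<open>p \<in> w\<close> for p q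
    using that w by (simp add: mcs_simps)
  have mem: \<open>v \<in> proof_set \<chi> \<longleftrightarrow> \<chi> \<in> v\<close> if \<open>v \<in> can_cell a w\<close> for v \<chi>
    using can_cell_mcs[OF that] by (simp add: proof_set_def)
  have \<open>\<phi> \<in> v \<longleftrightarrow> \<phi>' \<in> v\<close> if \<open>v \<in> can_cell a w\<close> for v
    using \<phi> that mem[OF that] by blast
  then have \<open>Know a (\<phi> \<^bold>\<longleftrightarrow> \<phi>') \<in> w\<close>
    unfolding mcs_Know[OF w] by (simp add: can_cell_mcs mcs_simps)
  moreover have \<open>\<phi> \<in> v \<Longrightarrow> \<psi> \<in> v \<Longrightarrow> \<psi>' \<in> v\<close> if \<open>v \<in> can_cell a w\<close> for v
    using \<psi> that mem[OF that] by blast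
  then have \<open>Know a (\<phi> \<^bold>\<and> \<psi> \<^bold>\<longrightarrow> \<psi>') \<in> w\<close>
    unfolding mcs_Know[OF w] by (simp add: can_cell_mcs mcs_simps)
  moreover have \<open>Bel a \<phi> (\<phi> \<^bold>\<and> \<psi>) \<in> w\<close>
    using B by (rule mcs_mp[OF w C])
  ultimately show ?thesis
    using mp mcs_mp[OF w M] mcs_mp[OF w EC] by metis
qed

lemma mcs_Bel_Neg: \<open>mcs w \<Longrightarrow> Bel a \<phi> \<psi> \<in> w \<Longrightarrow> Bel a \<phi> (\<^bold>\<not> \<psi>) \<notin> w\<close>
  using mcs_mp[OF _ D] mcs_Neg by metis

text \<open>The world \<open>v\<close> witnesses the possibility premise of axiom SC.\<close>

lemma mcs_Bel_Dis:
  assumes \<open>mcs w\<close> \<open>Bel a \<chi> (\<^bold>\<not> \<phi>) \<notin> w\<close> \<open>v \<in> can_cell a w\<close> \<open>\<chi> \<in> v\<close> \<open>\<phi> \<notin> v\<close> \<open>\<psi> \<in> v\<close>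
  shows \<open>Bel a \<chi> (\<phi> \<^bold>\<or> \<psi>) \<in> w\<close>
proof -
  have \<open>mcs v\<close>
    using assms(3) by (rule can_cell_mcs)
  then have \<open>\<^bold>\<not> (\<chi> \<^bold>\<and> \<^bold>\<not> \<phi> \<^bold>\<and> \<psi>) \<notin> v\<close>
    using assms by (simp add: mcs_simps)
  then have \<open>Know a (\<^bold>\<not> (\<chi> \<^bold>\<and> \<^bold>\<not> \<phi> \<^bold>\<and> \<psi>)) \<notin> w\<close>
    using mcs_Know[OF assms(1)] assms(3) by metis
  then have \<open>\<^bold>\<not> Bel a \<chi> (\<^bold>\<not> \<phi>) \<^bold>\<and> Know_dual a (\<chi> \<^bold>\<and> \<^bold>\<not> \<phi> \<^bold>\<and> \<psi>) \<in> w\<close>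
    using assms(1,2) mcs_Con mcs_Neg by metis
  then show ?thesis
    by (rule mcs_mp[OF assms(1) SC])
qed

section \<open>Extending neighbourhood families\<close>

text \<open>Conditions (c), (d) and (sc) for a fixed \<open>A\<close>, with all sets confined to
  \<open>S\<close>. With \<open>S\<close> the definable sets this is what the axioms provide; with
  \<open>S = Pow A\<close> it is what a model requires.\<close>

definition nbh_family :: \<open>'w set \<Rightarrow> 'w set set \<Rightarrow> 'w set set \<Rightarrow> bool\<close> where
  \<open>nbh_family A S F \<longleftrightarrow> F \<subseteq> S \<and> (\<forall>Y \<in> F. A - Y \<notin> F) \<and>
     (\<forall>Y \<in> S. \<forall>Z \<in> S. A - Y \<notin> F \<longrightarrow> Y \<subset> Z \<longrightarrow> Z \<in> F)\<close>

text \<open>Membership in \<open>F\<close> can be read as outweighing the complement in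
  \<open>A\<close>; a tied set and its complement balance each other.\<close>

definition tied :: \<open>'w set \<Rightarrow> 'w set set \<Rightarrow> 'w set set \<Rightarrow> 'w set set\<close> where
  \<open>tied A S F = {D \<in> S. D \<notin> F \<and> A - D \<notin> F}\<close>

text \<open>These sets belong to every family on \<open>Pow A\<close> that satisfies (d) and (sc)
  and agrees with \<open>F\<close> on \<open>S\<close>, for \<open>S\<close> closed under
  complement: the first kind by monotonicity, the second by (sc).\<close>

definition forced :: \<open>'w set \<Rightarrow> 'w set set \<Rightarrow> 'w set set \<Rightarrow> 'w set set\<close> where
  \<open>forced A S F = {Y \<in> Pow A. (\<exists>D \<in> F. D \<subseteq> Y) \<or> (\<exists>D \<in> tied A S F. D \<subset> Y)}\<close>

text \<open>The chosen point acts as a principal ultrafilter on the undecided sets: it picks one of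
  each complementary pair and respects inclusion. Tied sets are left out so that no definable set is
  added. For empty \<open>A\<close> the choice is arbitrary, but it lies in no subset of
  \<open>A\<close>.\<close>

definition completion :: \<open>'w set \<Rightarrow> 'w set set \<Rightarrow> 'w set set \<Rightarrow> 'w set set\<close> where
  \<open>completion A S F = forced A S F \<union>
     {Y \<in> Pow A. A - Y \<notin> forced A S F \<and> Y \<notin> tied A S F \<and> (SOME x. x \<in> A) \<in> Y}\<close>

locale partial_family =
  fixes A :: \<open>'w set\<close> and S F :: \<open>'w set set\<close>
  assumes S_sub: \<open>S \<subseteq> Pow A\<close> and S_compl: \<open>D \<in> S \<Longrightarrow> A - D \<in> S\<close>
    and F: \<open>nbh_family A S F\<close>
begin

lemma F_sub: \<open>D \<in> F \<Longrightarrow> D \<in> S\<close>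
  and F_d: \<open>D \<in> F \<Longrightarrow> A - D \<notin> F\<close>
  and F_sc: \<open>D \<in> S \<Longrightarrow> E \<in> S \<Longrightarrow> A - D \<notin> F \<Longrightarrow> D \<subset> E \<Longrightarrow> E \<in> F\<close>
  using F unfolding nbh_family_def by blast+

lemma compl_compl: \<open>Y \<subseteq> A \<Longrightarrow> A - (A - Y) = Y\<close>
  by blast

lemma tied_compl: \<open>D \<in> tied A S F \<Longrightarrow> A - D \<in> tied A S F\<close>
  using S_sub S_compl compl_compl unfolding tied_def by (auto simp: double_diff)

lemma forced_sub: \<open>Y \<in> forced A S F \<Longrightarrow> Y \<subseteq> A\<close>
  by (simp add: forced_def)

lemma forced_mono: \<open>Y \<in> forced A S F \<Longrightarrow> Y \<subseteq> Z \<Longrightarrow> Z \<subseteq> A \<Longrightarrow> Z \<in> forced A S F\<close>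
  by (simp add: forced_def) (metis order_trans psubset_subset_trans)

lemma tied_forced: \<open>D \<in> tied A S F \<Longrightarrow> D \<subset> Y \<Longrightarrow> Y \<subseteq> A \<Longrightarrow> Y \<in> forced A S F\<close>
  by (simp add: forced_def) metis

text \<open>Both ways of being forced in one format: a definable set below \<open>Y\<close> whose
  complement is not in \<open>F\<close>, and which is itself in \<open>F\<close> unless the
  inclusion is strict.\<close>

lemma forcedE:
  assumes \<open>Y \<in> forced A S F\<close>
  obtains D where \<open>D \<in> S\<close> \<open>A - D \<notin> F\<close> \<open>D \<subseteq> Y\<close> \<open>D = Y \<longrightarrow> D \<in> F\<close>
proof -
  consider D where \<open>D \<in> F\<close> \<open>D \<subseteq> Y\<close> | D where \<open>D \<in> tied A S F\<close> \<open>D \<subset> Y\<close>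
    using assms unfolding forced_def by blast
  then show ?thesis
  proof cases
    case 1
    show ?thesis by (rule that[of D]) (use 1 F_sub F_d in auto)
  next
    case 2
    then show ?thesis by (intro that[of D]) (auto simp: tied_def)
  qed
qed

text \<open>Definable sets \<open>D\<close> and \<open>E\<close> below \<open>Y\<close> and its
  complement are disjoint. If \<open>E\<close> is a proper subset of \<open>A - D\<close>, then (sc)
  puts \<open>A - D\<close> into \<open>F\<close>, which is excluded. Otherwise \<open>D\<close> and
  \<open>E\<close> fill \<open>Y\<close> and its complement, so both are in \<open>F\<close>,
  against (d).\<close>

lemma forced_d:
  assumes \<open>Y \<in> forced A S F\<close>
  shows \<open>A - Y \<notin> forced A S F\<close>
proof
  assume compl: \<open>A - Y \<in> forced A S F\<close>
  obtain D where D: \<open>D \<in> S\<close> \<open>A - D \<notin> F\<close> \<open>D \<subseteq> Y\<close> \<open>D = Y \<longrightarrow> D \<in> F\<close>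
    using assms by (rule forcedE)
  obtain E where E: \<open>E \<in> S\<close> \<open>A - E \<notin> F\<close> \<open>E \<subseteq> A - Y\<close> \<open>E = A - Y \<longrightarrow> E \<in> F\<close>
    using compl by (rule forcedE)
  have \<open>E \<subseteq> A - D\<close>
    using D(3) E(3) by blast
  then have \<open>E = A - D\<close>
    using F_sc[OF E(1) S_compl[OF D(1)] E(2)] D(2) by (metis psubsetI)
  moreover have \<open>D = Y\<close>
    using \<open>E = A - D\<close> D(3) E(3) forced_sub[OF assms] by blast
  ultimately show False
    using D E by simp
qed

lemma forced_definable:
  assumes \<open>D \<in> S\<close>
  shows \<open>D \<in> forced A S F \<longleftrightarrow> D \<in> F\<close>
proof
  assume \<open>D \<in> forced A S F\<close>
  then obtain E where \<open>E \<in> S\<close> \<open>A - E \<notin> F\<close> \<open>E \<subseteq> D\<close> \<open>E = D \<longrightarrow> E \<in> F\<close>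
    by (rule forcedE)
  then show \<open>D \<in> F\<close>
    using F_sc[OF _ assms] by (metis psubsetI)
next
  assume \<open>D \<in> F\<close>
  then show \<open>D \<in> forced A S F\<close>
    using assms S_sub unfolding forced_def by blast
qed

lemma F_or_tied: \<open>D \<in> S \<Longrightarrow> D \<in> F \<or> A - D \<in> F \<or> D \<in> tied A S F\<close>
  unfolding tied_def by blast

text \<open>A definable set outside \<open>F\<close> is tied or has its complement in
  \<open>F\<close>, hence forced; the point clause excludes both cases.\<close>

lemma completion_definable:
  assumes \<open>D \<in> S\<close>
  shows \<open>D \<in> completion A S F \<longleftrightarrow> D \<in> F\<close>
  using forced_definable[OF assms] forced_definable[OF S_compl[OF assms]] F_or_tied[OF assms]
  unfolding completion_def by auto

lemma completion_mono:
  assumes \<open>Y \<in> completion A S F\<close> \<open>Y \<subset> Z\<close> \<open>Z \<subseteq> A\<close>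
  shows \<open>Z \<in> completion A S F\<close>
proof (cases \<open>Y \<in> forced A S F\<close>)
  case True
  then have \<open>Z \<in> forced A S F\<close>
    using assms(2,3) by (intro forced_mono[OF True]) auto
  then show ?thesis
    by (simp add: completion_def)
next
  case False
  then have Y: \<open>A - Y \<notin> forced A S F\<close> \<open>(SOME x. x \<in> A) \<in> Y\<close>
    using assms(1) by (simp_all add: completion_def)
  have sub: \<open>A - Z \<subset> A - Y\<close>
    using assms(2,3) by blast
  have \<open>A - Z \<notin> forced A S F\<close>
    using Y(1) forced_mono[of \<open>A - Z\<close> \<open>A - Y\<close>] sub by blast
  \<comment> \<open>If \<open>Z\<close> were tied, so would be \<open>A - Z\<close>, and its proper
    superset \<open>A - Y\<close> would be forced.\<close>
  moreover have \<open>Z \<notin> tied A S F\<close>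
    using Y(1) tied_forced[OF tied_compl sub] by blast
  moreover have \<open>(SOME x. x \<in> A) \<in> Z\<close>
    using Y(2) assms(2) by blast
  ultimately show ?thesis
    using assms(3) by (simp add: completion_def)
qed

lemma completion_sub: \<open>Y \<in> completion A S F \<Longrightarrow> Y \<subseteq> A\<close>
  using forced_sub by (auto simp: completion_def)

lemma completion_family: \<open>nbh_family A (Pow A) (completion A S F)\<close>
  unfolding nbh_family_def
proof (intro conjI ballI impI)
  show \<open>completion A S F \<subseteq> Pow A\<close>
    using completion_sub by blast
next
  fix Y assume Y: \<open>Y \<in> completion A S F\<close>
  then show \<open>A - Y \<notin> completion A S F\<close>
    using forced_d[of Y] compl_compl[OF completion_sub[OF Y]] by (auto simp: completion_def)
next
  fix Y Z assume *: \<open>Y \<in> Pow A\<close> \<open>Z \<in> Pow A\<close> \<open>A - Y \<notin> completion A S F\<close> \<open>Y \<subset> Z\<close>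
  show \<open>Z \<in> completion A S F\<close>
  proof (cases \<open>Y \<in> tied A S F\<close>)
    case True
    then have \<open>Z \<in> forced A S F\<close>
      using * by (intro tied_forced[OF True]) auto
    then show ?thesis
      by (simp add: completion_def)
  next
    case False
    have Y: \<open>A - (A - Y) = Y\<close>
      using * by (intro compl_compl) simp
    then have \<open>A - Y \<notin> tied A S F\<close>
      using False tied_compl[of \<open>A - Y\<close>] by auto
    \<comment> \<open>\<open>A\<close> is non-empty because it includes \<open>Z\<close>, which
      properly includes \<open>Y\<close>. So a set that is not tied is settled one way or the other:
      since \<open>A - Y\<close> is rejected, \<open>Y\<close> is accepted, and monotonicity passes
      this on to \<open>Z\<close>.\<close>
    moreover have \<open>(SOME x. x \<in> A) \<in> A\<close>
      using *(2,4) some_in_eq by blast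
    ultimately have \<open>Y \<in> completion A S F\<close>
      using *(1,3) False Y by (auto simp: completion_def)
    then show ?thesis
      using *(2,4) completion_mono by blast
  qed
qed

end

section \<open>The canonical model\<close>

text \<open>The formula \<phi> only certifies that \<open>A\<close> is cut out of \<open>C\<close>
  by a formula; for any other \<open>A\<close> the collection is empty.\<close>

definition definable :: \<open>('p, 'a) fm set set \<Rightarrow> ('p, 'a) fm set set \<Rightarrow> ('p, 'a) fm set set set\<close> where
  \<open>definable C A = {A \<inter> proof_set \<psi> |\<phi> \<psi>. proof_set \<phi> \<inter> C = A}\<close>

definition believed ::
  \<open>'a \<Rightarrow> ('p, 'a) fm set \<Rightarrow> ('p, 'a) fm set set \<Rightarrow> ('p, 'a) fm set set set\<close> where
  \<open>believed a w A =
     {A \<inter> proof_set \<psi> |\<phi> \<psi>. proof_set \<phi> \<inter> can_cell a w = A \<and> Bel a \<phi> \<psi> \<in> w}\<close>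

text \<open>The value depends on \<open>X\<close> only through its intersection with the cell, so
  (ec) holds by construction.\<close>

definition can_nbh :: \<open>(('p, 'a) fm set, 'a) nbh\<close> where
  \<open>can_nbh a w X =
     completion (X \<inter> can_cell a w) (definable (can_cell a w) (X \<inter> can_cell a w))
       (believed a w (X \<inter> can_cell a w))\<close>

definition can_val :: \<open>'p \<Rightarrow> ('p, 'a) fm set set\<close> where
  \<open>can_val p = proof_set (Pro p)\<close>

section \<open>Definable and believed sets\<close>

lemma proof_set_Neg:
  assumes \<open>A \<subseteq> can_cell a w\<close>
  shows \<open>A - A \<inter> proof_set \<psi> = A \<inter> proof_set (\<^bold>\<not> \<psi>)\<close>
proof -
  have \<open>v \<in> proof_set (\<^bold>\<not> \<psi>) \<longleftrightarrow> v \<notin> proof_set \<psi>\<close> if \<open>v \<in> A\<close> for v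
    using can_cell_mcs[OF subsetD[OF assms that]] by (simp add: proof_set_def mcs_Neg)
  then show ?thesis
    by blast
qed

text \<open>By \<open>mcs_Bel_transfer\<close>, it does not matter which formulas represent the two
  sets.\<close>

lemma believed_iff:
  assumes \<open>mcs w\<close> and \<open>proof_set \<phi> \<inter> can_cell a w = A\<close>
  shows \<open>A \<inter> proof_set \<psi> \<in> believed a w A \<longleftrightarrow> Bel a \<phi> \<psi> \<in> w\<close>
proof
  assume \<open>A \<inter> proof_set \<psi> \<in> believed a w A\<close>
  then obtain \<phi>' \<psi>' where *: \<open>proof_set \<phi>' \<inter> can_cell a w = A\<close> \<open>Bel a \<phi>' \<psi>' \<in> w\<close>
    \<open>A \<inter> proof_set \<psi> = A \<inter> proof_set \<psi>'\<close>
    unfolding believed_def by blast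
  show \<open>Bel a \<phi> \<psi> \<in> w\<close>
    by (rule mcs_Bel_transfer[OF assms(1) *(2)]) (use * assms in blast)+
qed (use assms in \<open>auto simp: believed_def\<close>)

lemma definableE:
  assumes \<open>D \<in> definable C A\<close>
  obtains \<psi> where \<open>D = A \<inter> proof_set \<psi>\<close>
  using assms unfolding definable_def by blast

lemma definable_compl:
  assumes \<open>D \<in> definable (can_cell a w) A\<close>
  shows \<open>A - D \<in> definable (can_cell a w) A\<close>
proof -
  from assms obtain \<phi> \<psi> where *: \<open>proof_set \<phi> \<inter> can_cell a w = A\<close> \<open>D = A \<inter> proof_set \<psi>\<close>
    unfolding definable_def by blast
  have \<open>A - D = A \<inter> proof_set (\<^bold>\<not> \<psi>)\<close>
    unfolding *(2) using *(1) by (intro proof_set_Neg[of _ a w]) auto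
  then show ?thesis
    using *(1) unfolding definable_def by blast
qed

lemma believed_family:
  assumes w: \<open>mcs w\<close> and \<phi>: \<open>proof_set \<phi> \<inter> can_cell a w = A\<close>
  shows \<open>nbh_family A (definable (can_cell a w) A) (believed a w A)\<close>
  unfolding nbh_family_def
proof (intro conjI ballI impI)
  have A: \<open>A \<subseteq> can_cell a w\<close>
    using \<phi> by blast
  note compl = proof_set_Neg[OF A] and B = believed_iff[OF w \<phi>]
  show sub: \<open>believed a w A \<subseteq> definable (can_cell a w) A\<close>
    unfolding believed_def definable_def by blast
  show \<open>A - Y \<notin> believed a w A\<close> if Y: \<open>Y \<in> believed a w A\<close> for Y
  proof -
    obtain \<psi> where \<psi>: \<open>Y = A \<inter> proof_set \<psi>\<close>
      using subsetD[OF sub Y] by (rule definableE)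
    show ?thesis
      using Y mcs_Bel_Neg[OF w] unfolding \<psi> compl B by metis
  qed
  fix Y Z
  assume Y: \<open>Y \<in> definable (can_cell a w) A\<close> and Z: \<open>Z \<in> definable (can_cell a w) A\<close>
    and *: \<open>A - Y \<notin> believed a w A\<close> \<open>Y \<subset> Z\<close>
  obtain \<psi> where \<psi>: \<open>Y = A \<inter> proof_set \<psi>\<close> using Y by (rule definableE)
  obtain \<theta> where \<theta>: \<open>Z = A \<inter> proof_set \<theta>\<close> using Z by (rule definableE)
  obtain v where v: \<open>v \<in> Z\<close> \<open>v \<notin> Y\<close> using *(2) by blast
  \<comment> \<open>Axiom SC yields only a disjunction. As \<open>Y\<close> is included in
    \<open>Z\<close>, the disjunction and \<theta> define the same subset of \<open>A\<close>, and
    the belief transfers to \<theta>.\<close>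
  have \<open>Bel a \<phi> (\<psi> \<^bold>\<or> \<theta>) \<in> w\<close>
  proof (rule mcs_Bel_Dis[OF w])
    show \<open>Bel a \<phi> (\<^bold>\<not> \<psi>) \<notin> w\<close>
      using *(1) unfolding \<psi> compl B .
    show \<open>v \<in> can_cell a w\<close> \<open>\<phi> \<in> v\<close> \<open>\<psi> \<notin> v\<close> \<open>\<theta> \<in> v\<close>
      using v \<phi> unfolding \<psi> \<theta> proof_set_def by blast+
  qed
  moreover have \<open>proof_set \<phi> \<inter> proof_set (\<psi> \<^bold>\<or> \<theta>) \<inter> can_cell a w \<subseteq> proof_set \<theta>\<close>
  proof
    fix u assume u: \<open>u \<in> proof_set \<phi> \<inter> proof_set (\<psi> \<^bold>\<or> \<theta>) \<inter> can_cell a w\<close>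
    then have \<open>u \<in> A\<close> \<open>u \<in> proof_set \<psi> \<union> proof_set \<theta>\<close>
      using \<phi> by (auto simp: proof_set_def mcs_simps)
    then show \<open>u \<in> proof_set \<theta>\<close>
      using *(2) unfolding \<psi> \<theta> by blast
  qed
  ultimately have \<open>Bel a \<phi> \<theta> \<in> w\<close>
    by (rule mcs_Bel_transfer[OF w _ refl])
  then show \<open>Z \<in> believed a w A\<close>
    unfolding \<theta> B .
qed

text \<open>If no formula cuts out \<open>A\<close>, both collections are empty and the conditions
  hold vacuously; the completion is then governed by the chosen point alone.\<close>

lemma can_partial_family:
  assumes w: \<open>mcs w\<close>
  shows \<open>partial_family A (definable (can_cell a w) A) (believed a w A)\<close>
proof
  show \<open>definable (can_cell a w) A \<subseteq> Pow A\<close>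
    by (auto simp: definable_def)
  show \<open>A - D \<in> definable (can_cell a w) A\<close> if \<open>D \<in> definable (can_cell a w) A\<close> for D
    using that by (rule definable_compl)
  show \<open>nbh_family A (definable (can_cell a w) A) (believed a w A)\<close>
  proof (cases \<open>\<exists>\<phi>. proof_set \<phi> \<inter> can_cell a w = A\<close>)
    case True
    then show ?thesis using believed_family[OF w] by blast
  next
    case False
    then have \<open>definable (can_cell a w) A = {}\<close> \<open>believed a w A = {}\<close>
      unfolding definable_def believed_def by blast+
    then show ?thesis by (simp add: nbh_family_def)
  qed
qed

section \<open>Neighbourhoods and cells of the canonical model\<close>

lemma can_nbh_family:
  assumes \<open>mcs w\<close>
  shows \<open>nbh_family (X \<inter> can_cell a w) (Pow (X \<inter> can_cell a w)) (can_nbh a w X)\<close>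
  unfolding can_nbh_def
  by (rule partial_family.completion_family[OF can_partial_family[OF assms]])

lemma can_nbh_sub: \<open>mcs w \<Longrightarrow> Y \<in> can_nbh a w X \<Longrightarrow> Y \<subseteq> X \<inter> can_cell a w\<close>
  using can_nbh_family[of w X a] unfolding nbh_family_def by blast

lemma can_nbh_d: \<open>mcs w \<Longrightarrow> Y \<in> can_nbh a w X \<Longrightarrow> X \<inter> can_cell a w - Y \<notin> can_nbh a w X\<close>
  using can_nbh_family[of w X a] unfolding nbh_family_def by metis

lemma can_nbh_sc:
  assumes \<open>mcs w\<close> \<open>Z \<subseteq> X \<inter> can_cell a w\<close> \<open>X \<inter> can_cell a w - Y \<notin> can_nbh a w X\<close> \<open>Y \<subset> Z\<close>
  shows \<open>Z \<in> can_nbh a w X\<close>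
proof -
  have \<open>Y \<in> Pow (X \<inter> can_cell a w)\<close> \<open>Z \<in> Pow (X \<inter> can_cell a w)\<close>
    using assms(2,4) by blast+
  then show ?thesis
    using can_nbh_family[OF assms(1), of X a] assms(3,4) unfolding nbh_family_def by metis
qed

text \<open>Everything in the construction, including the chosen point, depends on the world only
  through its cell and the beliefs of \<open>a\<close>.\<close>

lemma can_nbh_cell:
  assumes \<open>v \<in> can_cell a w\<close>
  shows \<open>can_nbh a v X = can_nbh a w X\<close>
proof -
  have \<open>believed a v A = believed a w A\<close> for A
    using assms unfolding believed_def can_cell_eq[OF assms] by (auto simp: can_cell_def)
  then show ?thesis
    by (simp add: can_nbh_def can_cell_eq[OF assms])
qed

lemma cell_can_nbh:
  assumes w: \<open>mcs w\<close>
  shows \<open>cell worlds can_nbh a w = can_cell a w\<close>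
proof
  show \<open>can_cell a w \<subseteq> cell worlds can_nbh a w\<close>
    unfolding cell_def worlds_def using can_nbh_cell[of _ a w] can_cell_mcs[of _ a w] by blast
  show \<open>cell worlds can_nbh a w \<subseteq> can_cell a w\<close>
  proof
    fix v assume \<open>v \<in> cell worlds can_nbh a w\<close>
    then have v: \<open>mcs v\<close> and eq: \<open>can_nbh a w worlds = can_nbh a v worlds\<close>
      by (auto simp: cell_def worlds_def)
    have mem: \<open>v \<in> worlds \<inter> can_cell a v\<close>
      using v can_cell_refl[OF v] by (simp add: worlds_def)
    \<comment> \<open>The cell of \<open>v\<close> is non-empty, so (sc) with the empty set as the
      smaller set makes it a neighbourhood at \<open>v\<close>. It is then one at \<open>w\<close>
      too, and neighbourhoods at \<open>w\<close> stay inside the cell of \<open>w\<close>.\<close>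
    then have \<open>worlds \<inter> can_cell a v \<in> can_nbh a v worlds\<close>
      using can_nbh_sc[OF v, of \<open>worlds \<inter> can_cell a v\<close> worlds a \<open>{}\<close>]
      unfolding Diff_empty by blast
    then have \<open>worlds \<inter> can_cell a v \<subseteq> can_cell a w\<close>
      using can_nbh_sub[OF w] unfolding eq[symmetric] by blast
    then show \<open>v \<in> can_cell a w\<close>
      using mem by blast
  qed
qed

lemma can_model:
  assumes \<open>worlds \<noteq> ({} :: ('p, 'a) fm set set)\<close>
  shows \<open>cn_model worlds can_nbh (can_val :: 'p \<Rightarrow> ('p, 'a) fm set set)\<close>
  unfolding cn_model_def
proof (intro conjI allI impI ballI)
  show \<open>worlds \<noteq> ({} :: ('p, 'a) fm set set)\<close> by fact
  show \<open>can_val p \<subseteq> (worlds :: ('p, 'a) fm set set)\<close> for p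
    by (auto simp: can_val_def proof_set_def worlds_def)
next
  fix a and w :: \<open>('p, 'a) fm set\<close> and X :: \<open>('p, 'a) fm set set\<close>
  assume \<open>w \<in> worlds\<close> and X: \<open>X \<subseteq> worlds\<close>
  then have w: \<open>mcs w\<close> by (simp add: worlds_def)
  note cell = cell_can_nbh[OF w]
  show \<open>can_nbh a w X \<subseteq> Pow worlds\<close>
    using can_nbh_sub[OF w] X by blast
  show \<open>Y \<subseteq> X \<inter> cell worlds can_nbh a w\<close> if \<open>Y \<in> can_nbh a w X\<close> for Y
    using that can_nbh_sub[OF w] unfolding cell by blast
  show \<open>can_nbh a w X = can_nbh a w Y\<close>
    if \<open>X \<inter> cell worlds can_nbh a w = Y \<inter> cell worlds can_nbh a w\<close> for Y
    using that unfolding cell can_nbh_def by simp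
  show \<open>X \<inter> cell worlds can_nbh a w - Y \<notin> can_nbh a w X\<close> if \<open>Y \<in> can_nbh a w X\<close> for Y
    using that can_nbh_d[OF w] unfolding cell by blast
  show \<open>Z \<in> can_nbh a w X\<close>
    if \<open>Z \<subseteq> X \<inter> cell worlds can_nbh a w\<close> \<open>X \<inter> cell worlds can_nbh a w - Y \<notin> can_nbh a w X\<close> \<open>Y \<subset> Z\<close>
    for Y Z
    using that can_nbh_sc[OF w] unfolding cell by blast
qed

text \<open>A witness, definable or not, can be enlarged to the largest candidate by (d) and (sc).
  That candidate is definable, and on definable sets the completion agrees with the beliefs in
  \<open>w\<close>.\<close>

lemma can_nbh_proof_set:
  assumes w: \<open>mcs w\<close>
  shows \<open>(\<exists>Y \<in> can_nbh a w (proof_set \<phi>). Y \<subseteq> proof_set \<psi>) \<longleftrightarrow> Bel a \<phi> \<psi> \<in> w\<close>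
proof -
  let ?A = \<open>proof_set \<phi> \<inter> can_cell a w\<close>
  have \<open>?A \<inter> proof_set \<psi> \<in> definable (can_cell a w) ?A\<close>
    unfolding definable_def by blast
  then have iff: \<open>?A \<inter> proof_set \<psi> \<in> can_nbh a w (proof_set \<phi>) \<longleftrightarrow> Bel a \<phi> \<psi> \<in> w\<close>
    unfolding can_nbh_def
    using partial_family.completion_definable[OF can_partial_family[OF w]] believed_iff[OF w refl]
    by blast
  have \<open>?A \<inter> proof_set \<psi> \<in> can_nbh a w (proof_set \<phi>)\<close>
    if Y: \<open>Y \<in> can_nbh a w (proof_set \<phi>)\<close> \<open>Y \<subseteq> proof_set \<psi>\<close> for Y
  proof (cases \<open>Y = ?A \<inter> proof_set \<psi>\<close>)
    case False
    then show ?thesis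
      using Y can_nbh_sub[OF w Y(1)] by (intro can_nbh_sc[OF w _ can_nbh_d[OF w Y(1)]]) auto
  qed (use Y in simp)
  then show ?thesis
    using iff by blast
qed

section \<open>Truth lemma and completeness\<close>

lemma truth_lemma: \<open>mcs w \<Longrightarrow> sat worlds can_nbh can_val w \<phi> \<longleftrightarrow> \<phi> \<in> w\<close>
proof (induction \<phi> arbitrary: w)
  case (Bel a \<phi> \<psi>)
  have \<open>{v \<in> worlds. sat worlds can_nbh can_val v \<chi>} = proof_set \<chi>\<close> if \<open>\<chi> \<in> {\<phi>, \<psi>}\<close> for \<chi>
    using that Bel.IH by (auto simp: worlds_def proof_set_def)
  then show ?case
    using can_nbh_proof_set[OF Bel.prems] by simp
qed (auto simp: mcs_simps can_val_def proof_set_def)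

lemma CN_complete:
  fixes \<phi> :: \<open>('p, 'a) fm\<close>
  assumes \<open>cn_valid TYPE(('p, 'a) fm set) \<phi>\<close>
  shows \<open>\<turnstile> \<phi>\<close>
proof (rule ccontr)
  assume \<open>\<not> \<turnstile> \<phi>\<close>
  \<comment> \<open>The negation of an underivable formula is consistent over the empty set of
    hypotheses. The resulting world refutes the formula and also shows that \<open>worlds\<close> is
    non-empty, as \<open>can_model\<close> requires.\<close>
  then obtain w where w: \<open>mcs w\<close> \<open>\<^bold>\<not> \<phi> \<in> w\<close>
    using Lindenbaum[OF consistent_insert] Der_empty by blast
  then have \<open>w \<in> worlds\<close>
    by (simp add: worlds_def)
  then have \<open>sat worlds can_nbh can_val w \<phi>\<close>
    using assms can_model unfolding cn_valid_def by blast
  then show False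
    using w truth_lemma mcs_Neg by blast
qed

theorem theorem1:
  fixes \<phi> :: "('p, 'a::finite) fm"
  shows "(\<turnstile> \<phi> \<longleftrightarrow> cn_valid TYPE(('p, 'a) fm set) \<phi>) \<and> (\<turnstile> \<phi> \<longrightarrow> cn_valid TYPE('w) \<phi>)"
  by (intro conjI iffI impI) (erule CN_sound CN_complete)+

end
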